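(* Let $G$ be a finite set of finite sets with the constant energy function $h(x)=1$ for all $x\in G$. Then the matrices $L^{++}$ and $L^{--}$ define unimodular integral lattices given by a positive definite quadratic form of determinant $1$; that is, each of $L^{++}$ and $L^{--}$ is a symmetric, positive definite matrix with integer entries and determinant $1$.
   Context: For $x\in G$ let $W^+(x)=\{y\in G: x\subset y\}$ and $W^-(x)=\{y\in G: y\subset x\}$ (both include $x$). For $A\subset G$ put $E[A]=\sum_{x\in A}h(x)$, which for $h=1$ is the cardinality of $A$. The matrices, indexed by $G\times G$, are $L^{--}(x,y)=E[W^-(x)\cap W^-(y)]$ and $L^{++}(x,y)=E[W^+(x)\cap W^+(y)]$. No closure property of $G$ under subsets is assumed. *)

theory Defs
  imports "Jordan_Normal_Form.Determinant"
begin

definition W_plus :: "'a set set \<Rightarrow> 'a set \<Rightarrow> 'a set set" where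
  "W_plus G x = {y \<in> G. x \<subseteq> y}"

definition W_minus :: "'a set set \<Rightarrow> 'a set \<Rightarrow> 'a set set" where
  "W_minus G x = {y \<in> G. y \<subseteq> x}"

definition energy :: "('a set \<Rightarrow> real) \<Rightarrow> 'a set set \<Rightarrow> real" where
  "energy h A = (\<Sum>x\<in>A. h x)"

definition L_plus_plus :: "'a set set \<Rightarrow> ('a set \<Rightarrow> real) \<Rightarrow> 'a set \<Rightarrow> 'a set \<Rightarrow> real" where
  "L_plus_plus G h x y = energy h (W_plus G x \<inter> W_plus G y)"

definition L_minus_minus :: "'a set set \<Rightarrow> ('a set \<Rightarrow> real) \<Rightarrow> 'a set \<Rightarrow> 'a set \<Rightarrow> real" where
  "L_minus_minus G h x y = energy h (W_minus G x \<inter> W_minus G y)"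

(* The square matrix of a kernel L on the index set enumerated by the (distinct) list xs,
   with rows and columns in the same order. *)
definition indexed_mat :: "'b list \<Rightarrow> ('b \<Rightarrow> 'b \<Rightarrow> 'c) \<Rightarrow> 'c mat" where
  "indexed_mat xs L = mat (length xs) (length xs) (\<lambda>(i, j). L (xs ! i) (xs ! j))"

(* Symmetry is not included. *)
definition pos_definite :: "real mat \<Rightarrow> bool" where
  "pos_definite A \<longleftrightarrow> square_mat A \<and>
     (\<forall>v \<in> carrier_vec (dim_row A). v \<noteq> 0\<^sub>v (dim_row A) \<longrightarrow> v \<bullet> (A *\<^sub>v v) > 0)"

end

theory Submission
  imports Defs
begin

text \<open>Each matrix is a Gram matrix. Entry \<open>(x, y)\<close> counts the \<open>z \<in> G\<close> that lie above
  both \<open>x\<close> and \<open>y\<close> (for \<open>L\<^sup>+\<^sup>+\<close>), or below both (for \<open>L\<^sup>-\<^sup>-\<close>). A sum of products of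
  indicators computes this count, so the matrix is \<open>Z Z\<^sup>T\<close>, where \<open>Z\<close> is the 0-1 matrix of
  the order \<open>\<subseteq>\<close> (respectively \<open>\<supseteq>\<close>) on \<open>G\<close>, the zeta function of its incidence algebra.
  The two cases differ only by reversing the order and are treated together in
  \<open>common_bounds_matrix_unimodular\<close>.

  What remains is \<open>det Z = 1\<close> (\<open>det_zeta_matrix\<close>). Along a linear extension of the order \<open>Z\<close>
  is unitriangular, but the rows and columns come in an arbitrary order. The Leibniz formula
  makes re-enumeration unnecessary: the term of a permutation \<open>p\<close> survives only if
  \<open>i \<le> p i\<close> for all \<open>i\<close>, and the only such permutation of a finite poset is the identity.
  Then \<open>Z Z\<^sup>T\<close> has determinant 1, and its quadratic form \<open>v \<mapsto> |Z\<^sup>T v|\<^sup>2\<close> is positive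
  definite because \<open>Z\<^sup>T\<close> is injective (\<open>unimodular_gram_matrix\<close>).\<close>

text \<open>A permutation that moves every point upwards maps the finite up-set of \<open>i\<close> into itself,
  hence onto itself. So \<open>i\<close> is the image of some point above it, and as that point only moves
  up, it must be \<open>i\<close> itself.\<close>

lemma increasing_permutation_trivial:
  assumes fin: "finite S" and p: "p permutes S"
    and trans: "\<And>i j k. \<lbrakk>i \<in> S; j \<in> S; k \<in> S; R i j; R j k\<rbrakk> \<Longrightarrow> R i k"
    and antisym: "\<And>i j. \<lbrakk>i \<in> S; j \<in> S; R i j; R j i\<rbrakk> \<Longrightarrow> i = j"
    and incr: "\<And>i. i \<in> S \<Longrightarrow> R i (p i)"
  shows "p = id"
proof
  fix i
  show "p i = id i"
  proof (cases "i \<in> S")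
    case False
    then show ?thesis using p by (simp add: permutes_not_in)
  next
    case True
    let ?U = "{j \<in> S. j = i \<or> R i j}"
    have inS: "p j \<in> S \<longleftrightarrow> j \<in> S" for j by (rule permutes_in_image[OF p])
    have maps: "p ` ?U \<subseteq> ?U" using trans incr inS True by blast
    have "inj_on p ?U" using permutes_inj[OF p] by (rule inj_on_subset) simp
    then have "p ` ?U = ?U" using maps fin by (intro endo_inj_surj) auto
    then obtain j where j: "j \<in> ?U" and pj: "p j = i" using True by force
    then have "j = i" using antisym[of i j] incr[of j] True by auto
    then show ?thesis using pj by simp
  qed
qed

text \<open>By \<open>increasing_permutation_trivial\<close> the identity contributes the only nonzero term of the
  Leibniz formula.\<close>

lemma det_zeta_matrix:
  assumes refl: "\<And>i. i < n \<Longrightarrow> R i i"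
    and trans: "\<And>i j k. \<lbrakk>i < n; j < n; k < n; R i j; R j k\<rbrakk> \<Longrightarrow> R i k"
    and antisym: "\<And>i j. \<lbrakk>i < n; j < n; R i j; R j i\<rbrakk> \<Longrightarrow> i = j"
  shows "det (mat n n (\<lambda>(i, j). if R i j then 1 else 0)) = (1 :: 'c :: comm_ring_1)"
proof -
  let ?Z = "mat n n (\<lambda>(i, j). if R i j then 1 else 0) :: 'c mat"
  let ?P = "{p. p permutes {0..<n}}"
  let ?t = "\<lambda>p. signof p * (\<Prod>i = 0..<n. ?Z $$ (i, p i)) :: 'c"
  have vanish: "?t p = 0" if p: "p \<in> ?P" and "p \<noteq> id" for p
  proof -
    have "\<not> (\<forall>i \<in> {0..<n}. R i (p i))"
    proof
      assume "\<forall>i \<in> {0..<n}. R i (p i)"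
      then have "p = id"
        using p by (intro increasing_permutation_trivial[of "{0..<n}" p R])
          (auto intro: antisym elim: trans)
      then show False using \<open>p \<noteq> id\<close> by simp
    qed
    then obtain i where i: "i \<in> {0..<n}" and "\<not> R i (p i)" by blast
    moreover have "p i < n" using p i permutes_in_image[of p "{0..<n}" i] by simp
    ultimately have "?Z $$ (i, p i) = 0" by simp
    then have "(\<Prod>i = 0..<n. ?Z $$ (i, p i)) = 0" using i by (intro prod_zero) auto
    then show ?thesis by simp
  qed
  have "det ?Z = sum ?t ?P" by (simp add: det_def)
  also have "\<dots> = sum ?t {id}"
    using vanish by (intro sum.mono_neutral_right) (auto simp: finite_permutations permutes_id)
  also have "\<dots> = 1" using refl by (simp add: sign_id)
  finally show ?thesis .
qed

text \<open>Positivity comes from \<open>v \<bullet> B B\<^sup>T v = B\<^sup>T v \<bullet> B\<^sup>T v\<close>, and definiteness from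
  \<open>det B\<^sup>T = 1\<close>, which leaves \<open>B\<^sup>T\<close> with trivial kernel.\<close>

lemma unimodular_gram_matrix:
  fixes B :: "real mat"
  assumes B: "B \<in> carrier_mat n n" and det: "det B = 1" and int: "elements_mat B \<subseteq> \<int>"
  defines "A \<equiv> B * transpose_mat B"
  shows "transpose_mat A = A \<and> pos_definite A \<and> elements_mat A \<subseteq> \<int> \<and> det A = 1"
proof (intro conjI)
  have BT: "transpose_mat B \<in> carrier_mat n n" using B by simp
  show "transpose_mat A = A" unfolding A_def using transpose_mult[OF B BT] by simp
  have detT: "det (transpose_mat B) = 1" using det det_transpose[OF B] by simp
  show "det A = 1" unfolding A_def using det_mult[OF B BT] det detT by simp
  show "elements_mat A \<subseteq> \<int>"
  proof
    fix a assume "a \<in> elements_mat A"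
    then obtain i j where ij: "i < n" "j < n" and a: "a = row B i \<bullet> row B j"
      using B by (auto simp: A_def elements_mat_def)
    have "B $$ (i, k) \<in> \<int>" if "i < n" "k < n" for i k
      using int elements_matI[OF B that] by blast
    then show "a \<in> \<int>" using a ij B by (auto simp: scalar_prod_def intro!: Ints_sum)
  qed
  show "pos_definite A"
    unfolding pos_definite_def
  proof (intro conjI ballI impI)
    show "square_mat A" using B by (simp add: A_def)
    fix v :: "real vec" assume "v \<in> carrier_vec (dim_row A)" and "v \<noteq> 0\<^sub>v (dim_row A)"
    then have v: "v \<in> carrier_vec n" and v0: "v \<noteq> 0\<^sub>v n" using B by (auto simp: A_def)
    let ?w = "transpose_mat B *\<^sub>v v"
    have w: "?w \<in> carrier_vec n" using BT v by simp
    have "?w \<noteq> 0\<^sub>v n"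
      using det_0_iff_vec_prod_zero[OF BT] detT v v0 by auto
    \<comment> \<open>\<open>conjugate_square_greater_0_vec\<close> is about the Hermitian product; over the reals
      conjugation is trivial.\<close>
    moreover have "conjugate ?w = ?w" by (intro eq_vecI) simp_all
    ultimately have "?w \<bullet> ?w > 0" using conjugate_square_greater_0_vec[OF w] by metis
    also have "?w \<bullet> ?w = v \<bullet> (B *\<^sub>v ?w)"
      using transpose_vec_mult_scalar[OF B w v] by simp
    also have "B *\<^sub>v ?w = A *\<^sub>v v" unfolding A_def using B BT v by simp
    finally show "v \<bullet> (A *\<^sub>v v) > 0" .
  qed
qed

text \<open>Taking an abstract order \<open>R\<close> lets \<open>\<subseteq>\<close> and \<open>\<supseteq>\<close> be two instances of one result. The count
  of common upper bounds is the inner product of two rows of the zeta matrix of \<open>R\<close>.\<close>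

lemma common_bounds_matrix_unimodular:
  fixes xs :: "'b list" and R :: "'b \<Rightarrow> 'b \<Rightarrow> bool" and L :: "'b \<Rightarrow> 'b \<Rightarrow> real"
  assumes dist: "distinct xs"
    and refl: "\<And>x. R x x"
    and trans: "\<And>x y z. \<lbrakk>R x y; R y z\<rbrakk> \<Longrightarrow> R x z"
    and antisym: "\<And>x y. \<lbrakk>R x y; R y x\<rbrakk> \<Longrightarrow> x = y"
    and L: "\<And>x y. L x y = card {z \<in> set xs. R x z \<and> R y z}"
  defines "A \<equiv> indexed_mat xs L"
  shows "transpose_mat A = A \<and> pos_definite A \<and> elements_mat A \<subseteq> \<int> \<and> det A = 1"
proof -
  let ?n = "length xs"
  define B :: "real mat" where
    "B = mat ?n ?n (\<lambda>(i, j). if R (xs ! i) (xs ! j) then 1 else 0)"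
  have B: "B \<in> carrier_mat ?n ?n" by (simp add: B_def)
  have "det B = 1" unfolding B_def
  proof (rule det_zeta_matrix)
    fix i j assume "i < ?n" "j < ?n" "R (xs ! i) (xs ! j)" "R (xs ! j) (xs ! i)"
    then show "i = j" using antisym nth_eq_iff_index_eq[OF dist] by blast
  qed (rule refl, erule (1) trans)
  moreover have "elements_mat B \<subseteq> \<int>" by (auto simp: B_def elements_mat_def)
  moreover have "A = B * transpose_mat B"
  proof (rule eq_matI)
    fix i j assume "i < dim_row (B * transpose_mat B)" "j < dim_col (B * transpose_mat B)"
    then have ij: "i < ?n" "j < ?n" by (auto simp: B_def)
    let ?f = "\<lambda>z. if R (xs ! i) z \<and> R (xs ! j) z then 1 else 0 :: real"
    have "(B * transpose_mat B) $$ (i, j) = (\<Sum>k = 0..<?n. ?f (xs ! k))"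
      using ij by (auto simp: B_def scalar_prod_def intro!: sum.cong)
    also have "\<dots> = (\<Sum>z \<in> set xs. ?f z)"
      using sum.reindex_bij_betw[OF bij_betw_nth[OF dist HOL.refl HOL.refl], of ?f]
      by (simp add: atLeast0LessThan)
    also have "\<dots> = L (xs ! i) (xs ! j)" by (simp add: L sum.If_cases Int_def)
    finally show "A $$ (i, j) = (B * transpose_mat B) $$ (i, j)"
      using ij by (simp add: A_def indexed_mat_def)
  qed (simp_all add: A_def indexed_mat_def B_def)
  ultimately show ?thesis using unimodular_gram_matrix[OF B] by simp
qed

theorem corollary4:
  fixes G :: "'a set set" and h :: "'a set \<Rightarrow> real" and xs :: "'a set list"
  assumes "finite G"
    and "\<forall>x\<in>G. finite x"
    and "\<forall>x\<in>G. h x = 1"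
    and "distinct xs" and "set xs = G"
  shows "\<forall>A \<in> {indexed_mat xs (L_plus_plus G h), indexed_mat xs (L_minus_minus G h)}.
           transpose_mat A = A \<and> pos_definite A \<and> elements_mat A \<subseteq> \<int> \<and> det A = 1"
proof -
  have count: "energy h S = card S" if "S \<subseteq> G" for S
    using assms(3) that by (simp add: energy_def subset_iff)
  have "L_plus_plus G h x y = card {z \<in> set xs. x \<subseteq> z \<and> y \<subseteq> z}" for x y
  proof -
    have "W_plus G x \<inter> W_plus G y = {z \<in> set xs. x \<subseteq> z \<and> y \<subseteq> z}"
      using \<open>set xs = G\<close> by (auto simp: W_plus_def)
    then show ?thesis using count[of "W_plus G x \<inter> W_plus G y"]
      by (auto simp: L_plus_plus_def W_plus_def)
  qed
  moreover have "L_minus_minus G h x y = card {z \<in> set xs. x \<supseteq> z \<and> y \<supseteq> z}" for x y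
  proof -
    have "W_minus G x \<inter> W_minus G y = {z \<in> set xs. x \<supseteq> z \<and> y \<supseteq> z}"
      using \<open>set xs = G\<close> by (auto simp: W_minus_def)
    then show ?thesis using count[of "W_minus G x \<inter> W_minus G y"]
      by (auto simp: L_minus_minus_def W_minus_def)
  qed
  ultimately show ?thesis
    using common_bounds_matrix_unimodular[of xs "(\<subseteq>)" "L_plus_plus G h"]
      common_bounds_matrix_unimodular[of xs "(\<supseteq>)" "L_minus_minus G h"] \<open>distinct xs\<close>
    by auto
qed

end
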